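(* Let $k\ge 2$ be an integer and let $G$ and $H$ be graphs. If at least one of the graphs $G$ or $H$ admits a neighborhood-balanced $k$-coloring, then so does the direct product $G\times H$.
   Context: All graphs are finite, simple and undirected. A neighborhood-balanced $k$-coloring of a graph is a (not necessarily proper) vertex coloring with colors $1,\dots,k$ such that every vertex has the same number of neighbors of each of the $k$ colors. The direct product $G\times H$ has vertex set $V(G)\times V(H)$, and $(u,v)$ and $(u',v')$ are adjacent if and only if $uu'\in E(G)$ and $vv'\in E(H)$. *)

theory Defs
  imports "Graph_Theory.Pair_Digraph"
begin

text \<open>
  A finite simple undirected graph is a \<^locale>\<open>pair_graph\<close>: a finite vertex set together with
  a symmetric irreflexive edge relation on it, each undirected edge appearing as two opposite arcs.
  The null graph is allowed.
\<close>

definition neighborhood :: "'a pair_pre_digraph \<Rightarrow> 'a \<Rightarrow> 'a set" where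
  "neighborhood G v = {w \<in> pverts G. (v, w) \<in> parcs G}"

text \<open>Only the values of the coloring on the vertex set matter; not all colors need be used.\<close>

definition neighborhood_balanced_coloring ::
    "nat \<Rightarrow> 'a pair_pre_digraph \<Rightarrow> ('a \<Rightarrow> nat) \<Rightarrow> bool" where
  "neighborhood_balanced_coloring k G c \<longleftrightarrow>
     (\<forall>v \<in> pverts G. c v \<in> {1..k}) \<and>
     (\<forall>v \<in> pverts G. \<forall>i \<in> {1..k}. \<forall>j \<in> {1..k}.
        card {w \<in> neighborhood G v. c w = i} = card {w \<in> neighborhood G v. c w = j})"

definition admits_neighborhood_balanced_coloring ::
    "nat \<Rightarrow> 'a pair_pre_digraph \<Rightarrow> bool" where
  "admits_neighborhood_balanced_coloring k G \<longleftrightarrow>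
     (\<exists>c. neighborhood_balanced_coloring k G c)"

definition direct_product ::
    "'a pair_pre_digraph \<Rightarrow> 'b pair_pre_digraph \<Rightarrow> ('a \<times> 'b) pair_pre_digraph" where
  "direct_product G H =
     \<lparr> pverts = pverts G \<times> pverts H,
       parcs = {((u, v), (u', v')) | u v u' v'. (u, u') \<in> parcs G \<and> (v, v') \<in> parcs H} \<rparr>"

lemma pair_graph_direct_product:
  assumes "pair_graph G" and "pair_graph H"
  shows "pair_graph (direct_product G H)"
proof -
  interpret G: pair_graph G by fact
  interpret H: pair_graph H by fact
  let ?P = "direct_product G H"
  have sub: "parcs ?P \<subseteq> pverts ?P \<times> pverts ?P"
    by (auto simp: direct_product_def dest: G.arc_fst_in_verts G.arc_snd_in_verts
        H.arc_fst_in_verts H.arc_snd_in_verts)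
  have fin: "finite (pverts ?P)"
    by (simp add: direct_product_def)
  have "finite (parcs ?P)"
    using finite_subset[OF sub] fin by simp
  moreover have "symmetric ?P"
    using G.arcs_symmetric H.arcs_symmetric
    by (auto simp: symmetric_def sym_def arcs_ends_conv direct_product_def)
  moreover have "fst e \<noteq> snd e" if "e \<in> parcs ?P" for e
    using that G.no_loops by (auto simp: direct_product_def)
  ultimately show ?thesis
    using sub fin by unfold_locales auto
qed

end

theory Submission
  imports Defs
begin

text \<open>
  Pull the balanced coloring of one factor back along the projection. The neighborhood of a vertex
  of the product is the product of the neighborhoods in the two factors, so each color class in it
  is a color class of the colored factor's neighborhood times the whole other neighborhood. All
  color counts are thus multiplied by the same number, the degree in the other factor, and
  remain equal.
\<close>

lemma neighborhood_direct_product: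
  "neighborhood (direct_product G H) (u, v) = neighborhood G u \<times> neighborhood H v"
  by (auto simp: neighborhood_def direct_product_def)

lemma neighborhood_balanced_coloring_fst:
  assumes "neighborhood_balanced_coloring k G c"
  shows "neighborhood_balanced_coloring k (direct_product G H) (c \<circ> fst)"
proof -
  have count: "card {w \<in> neighborhood (direct_product G H) (u, v). (c \<circ> fst) w = i} =
      card {w \<in> neighborhood G u. c w = i} * card (neighborhood H v)" for u v i
  proof -
    have "{w \<in> neighborhood (direct_product G H) (u, v). (c \<circ> fst) w = i} =
        {w \<in> neighborhood G u. c w = i} \<times> neighborhood H v"
      by (auto simp: neighborhood_direct_product)
    then show ?thesis
      by (simp only: card_cartesian_product)
  qed
  have verts: "pverts (direct_product G H) = pverts G \<times> pverts H"
    by (simp add: direct_product_def)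
  have range: "\<forall>p \<in> pverts (direct_product G H). (c \<circ> fst) p \<in> {1..k}"
    using assms unfolding neighborhood_balanced_coloring_def verts by fastforce
  have balanced: "card {w \<in> neighborhood G u. c w = i} = card {w \<in> neighborhood G u. c w = j}"
    if "u \<in> pverts G" "i \<in> {1..k}" "j \<in> {1..k}" for u i j
    using assms that unfolding neighborhood_balanced_coloring_def by blast
  show ?thesis
    unfolding neighborhood_balanced_coloring_def
  proof (intro conjI ballI)
    fix p i j
    assume "p \<in> pverts (direct_product G H)" and ij: "i \<in> {1..k}" "j \<in> {1..k}"
    then obtain u v where p: "p = (u, v)" and "u \<in> pverts G"
      unfolding verts by blast
    from balanced[OF this(2) ij]
    show "card {w \<in> neighborhood (direct_product G H) p. (c \<circ> fst) w = i} =
        card {w \<in> neighborhood (direct_product G H) p. (c \<circ> fst) w = j}"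
      unfolding p count by (rule arg_cong)
  qed (use range in blast)
qed

lemma neighborhood_balanced_coloring_snd:
  assumes "neighborhood_balanced_coloring k H c"
  shows "neighborhood_balanced_coloring k (direct_product G H) (c \<circ> snd)"
proof -
  have count: "card {w \<in> neighborhood (direct_product G H) (u, v). (c \<circ> snd) w = i} =
      card (neighborhood G u) * card {w \<in> neighborhood H v. c w = i}" for u v i
  proof -
    have "{w \<in> neighborhood (direct_product G H) (u, v). (c \<circ> snd) w = i} =
        neighborhood G u \<times> {w \<in> neighborhood H v. c w = i}"
      by (auto simp: neighborhood_direct_product)
    then show ?thesis
      by (simp only: card_cartesian_product)
  qed
  have verts: "pverts (direct_product G H) = pverts G \<times> pverts H"
    by (simp add: direct_product_def)
  have range: "\<forall>p \<in> pverts (direct_product G H). (c \<circ> snd) p \<in> {1..k}"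
    using assms unfolding neighborhood_balanced_coloring_def verts by fastforce
  have balanced: "card {w \<in> neighborhood H v. c w = i} = card {w \<in> neighborhood H v. c w = j}"
    if "v \<in> pverts H" "i \<in> {1..k}" "j \<in> {1..k}" for v i j
    using assms that unfolding neighborhood_balanced_coloring_def by blast
  show ?thesis
    unfolding neighborhood_balanced_coloring_def
  proof (intro conjI ballI)
    fix p i j
    assume "p \<in> pverts (direct_product G H)" and ij: "i \<in> {1..k}" "j \<in> {1..k}"
    then obtain u v where p: "p = (u, v)" and "v \<in> pverts H"
      unfolding verts by blast
    from balanced[OF this(2) ij]
    show "card {w \<in> neighborhood (direct_product G H) p. (c \<circ> snd) w = i} =
        card {w \<in> neighborhood (direct_product G H) p. (c \<circ> snd) w = j}"
      unfolding p count by (rule arg_cong)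
  qed (use range in blast)
qed

theorem theorem3p3:
  fixes k :: nat and G :: "'a pair_pre_digraph" and H :: "'b pair_pre_digraph"
  assumes "k \<ge> 2" and "pair_graph G" and "pair_graph H"
    and "admits_neighborhood_balanced_coloring k G \<or> admits_neighborhood_balanced_coloring k H"
  shows "admits_neighborhood_balanced_coloring k (direct_product G H)"
  using assms(4) neighborhood_balanced_coloring_fst neighborhood_balanced_coloring_snd
  unfolding admits_neighborhood_balanced_coloring_def by blast

end
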